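(* Let $I$ be an arbitrary index set, $c\in\mathbb{R}^n$, and for each $\alpha\in I$ let $U_\alpha\subseteq\mathbb{R}^{n}\times\mathbb{R}$ be non-empty, compact and convex; put $\natural(\mathbf{U}):=\prod_{\alpha\in I}U_\alpha$. Consider the robust problem $\mathbf{RO}(\natural(\mathbf{U}))$: $\inf_{x\in\mathbb{R}^n}\langle c,x\rangle$ subject to $\langle a^\alpha,x\rangle\ge b^\alpha$ for all $(a^\alpha,b^\alpha)\in U_\alpha$ and all $\alpha\in I$. Suppose that: 1. $\mathbf{RO}(\natural(\mathbf{U}))$ satisfies the strong Slater condition with strong Slater constant $\rho>0$, i.e. there is $x_0\in\mathbb{R}^n$ with $\langle a^\alpha,x_0\rangle\ge b^\alpha+\rho$ for all $(a^\alpha,b^\alpha)\in U_\alpha$, $\alpha\in I$; 2. the optimal solution set $F^{\mathrm{opt}}(\mathbf{RO}(\natural(\mathbf{U})))$ is non-empty and bounded; 3. $\sup\{-b^\alpha:(a^\alpha,b^\alpha)\in U_\alpha,\ \alpha\in I\}<+\infty$. Then, with respect to the metric $\mathbf{d}_\natural$ on constraint-wise uncertainty sets (with $c$ and $I$ fixed): 1. the set-valued mapping $F^{\mathrm{opt}}(\mathbf{RO}(\cdot))$ is closed at $\natural(\mathbf{U})$; 2. $F^{\mathrm{opt}}(\mathbf{RO}(\cdot))$ is upper semi-continuous at $\natural(\mathbf{U})$.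
   Context: A constraint-wise uncertainty set is a product $\natural(\mathbf{V})=\prod_{\alpha\in I}V_\alpha$ with each $V_\alpha\subseteq\mathbb{R}^n\times\mathbb{R}$ non-empty, compact and convex. $\mathbf{RO}(\natural(\mathbf{V}))$ is the problem $\inf_x\langle c,x\rangle$ subject to $\langle a^\alpha,x\rangle\ge b^\alpha$ for all $(a^\alpha,b^\alpha)\in V_\alpha$, $\alpha\in I$, and $F^{\mathrm{opt}}(\mathbf{RO}(\natural(\mathbf{V})))\subseteq\mathbb{R}^n$ is its set of optimal solutions (feasible points attaining the optimal value). The distance is $\mathbf{d}_\natural(\natural(\mathbf{U}),\natural(\mathbf{V})):=\sup_{\alpha\in I}d_H(U_\alpha,V_\alpha)$ (possibly $+\infty$), where $d_H(C,D):=\max\{\sup_{u\in C}\inf_{v\in D}\|u-v\|,\ \sup_{v\in D}\inf_{u\in C}\|u-v\|\}$ is the Hausdorff distance for the Euclidean norm. Let $\mathcal{K}$ be a set-valued mapping from the space of constraint-wise uncertainty sets to subsets of $\mathbb{R}^n$ with $\mathcal{K}(\natural(\mathbf{U}))\ne\varnothing$. - $\mathcal{K}$ is closed at $\natural(\mathbf{U})$ if for all sequences $\natural(\mathbf{V}_j)$ and $x_j\in\mathcal{K}(\natural(\mathbf{V}_j))$ with $\mathbf{d}_\natural(\natural(\mathbf{V}_j),\natural(\mathbf{U}))\to0$ and $x_j\to\overline{x}\in\mathbb{R}^n$, one has $\overline{x}\in\mathcal{K}(\natural(\mathbf{U}))$. - $\mathcal{K}$ is upper semi-continuous at $\natural(\mathbf{U})$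 if for each open $\mathcal{O}\subseteq\mathbb{R}^n$ with $\mathcal{K}(\natural(\mathbf{U}))\subseteq\mathcal{O}$ there is a neighborhood $\mathcal{N}$ of $\natural(\mathbf{U})$ such that $\mathcal{K}(\natural(\mathbf{V}))\subseteq\mathcal{O}$ for all $\natural(\mathbf{V})\in\mathcal{N}$. *)

theory Defs
  imports "HOL-Analysis.Analysis"
begin

text \<open>A constraint-wise uncertainty set, the product of a family of non-empty compact convex
  sets indexed by \<open>I\<close>, is represented by the family of its factors: as the factors are non-empty,
  the product determines them.  The values of the family outside \<open>I\<close> are irrelevant.\<close>

type_synonym ('i, 'n) uncertainty = "'i \<Rightarrow> ((real ^ 'n) \<times> real) set"

definition uncertainty_sets :: "'i set \<Rightarrow> ('i, 'n::finite) uncertainty set" where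
  "uncertainty_sets I = {V. \<forall>\<alpha>\<in>I. V \<alpha> \<noteq> {} \<and> compact (V \<alpha>) \<and> convex (V \<alpha>)}"

definition RO_feasible :: "'i set \<Rightarrow> ('i, 'n::finite) uncertainty \<Rightarrow> (real ^ 'n) set" where
  "RO_feasible I V = {x. \<forall>\<alpha>\<in>I. \<forall>(a, b)\<in>V \<alpha>. a \<bullet> x \<ge> b}"

definition RO_value :: "'i set \<Rightarrow> real ^ 'n \<Rightarrow> ('i, 'n::finite) uncertainty \<Rightarrow> ereal" where
  "RO_value I c V = (INF x\<in>RO_feasible I V. ereal (c \<bullet> x))"

definition RO_opt :: "'i set \<Rightarrow> real ^ 'n \<Rightarrow> ('i, 'n::finite) uncertainty \<Rightarrow> (real ^ 'n) set" where
  "RO_opt I c V = {x \<in> RO_feasible I V. ereal (c \<bullet> x) = RO_value I c V}"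

definition strong_Slater :: "'i set \<Rightarrow> ('i, 'n::finite) uncertainty \<Rightarrow> real \<Rightarrow> bool" where
  "strong_Slater I V \<rho> \<longleftrightarrow> \<rho> > 0 \<and> (\<exists>x0. \<forall>\<alpha>\<in>I. \<forall>(a, b)\<in>V \<alpha>. a \<bullet> x0 \<ge> b + \<rho>)"

text \<open>Distances take values in \<^typ>\<open>ennreal\<close>, so that the supremum over \<open>I\<close> may be infinite
  (and is \<open>0\<close> if \<open>I\<close> is empty).  The library norm on a product type is the Euclidean one.\<close>

definition hausdorff_distance :: "'a::real_normed_vector set \<Rightarrow> 'a set \<Rightarrow> ennreal" where
  "hausdorff_distance C D =
     max (SUP u\<in>C. INF v\<in>D. ennreal (norm (u - v))) (SUP v\<in>D. INF u\<in>C. ennreal (norm (u - v)))"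

definition uncertainty_dist ::
    "'i set \<Rightarrow> ('i, 'n::finite) uncertainty \<Rightarrow> ('i, 'n) uncertainty \<Rightarrow> ennreal" where
  "uncertainty_dist I U V = (SUP \<alpha>\<in>I. hausdorff_distance (U \<alpha>) (V \<alpha>))"

definition closed_at ::
    "'i set \<Rightarrow> (('i, 'n::finite) uncertainty \<Rightarrow> (real ^ 'n) set) \<Rightarrow> ('i, 'n) uncertainty \<Rightarrow> bool" where
  "closed_at I K U \<longleftrightarrow>
     (\<forall>V x xbar. (\<forall>j::nat. V j \<in> uncertainty_sets I \<and> x j \<in> K (V j)) \<longrightarrow>
        (\<lambda>j. uncertainty_dist I (V j) U) \<longlonglongrightarrow> 0 \<longrightarrow> x \<longlonglongrightarrow> xbar \<longrightarrow> xbar \<in> K U)"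

text \<open>Neighbourhoods of \<open>U\<close> are the sets of constraint-wise uncertainty sets that contain
  a ball around \<open>U\<close>, so it suffices to quantify over balls.\<close>

definition upper_semicontinuous_at ::
    "'i set \<Rightarrow> (('i, 'n::finite) uncertainty \<Rightarrow> (real ^ 'n) set) \<Rightarrow> ('i, 'n) uncertainty \<Rightarrow> bool" where
  "upper_semicontinuous_at I K U \<longleftrightarrow>
     (\<forall>S. open S \<and> K U \<subseteq> S \<longrightarrow>
        (\<exists>\<epsilon>::real. \<epsilon> > 0 \<and>
           (\<forall>V\<in>uncertainty_sets I. uncertainty_dist I V U < ennreal \<epsilon> \<longrightarrow> K V \<subseteq> S)))"

end

theory Submission
  imports Defs
begin

text \<open>
  All estimates come from one observation: moving the data \<open>(a, b)\<close> of a constraint by less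
  than \<open>e\<close> changes the slack \<open>a \<bullet> x - b\<close> by at most \<open>e * (1 + norm x)\<close>, uniformly in the index
  \<open>\<alpha>\<close>, even though the data may be unbounded over \<open>I\<close>.

  Closedness.  Let \<open>x\<^sub>j\<close> be optimal for \<open>V\<^sub>j\<close>, \<open>V\<^sub>j \<rightarrow> U\<close> and \<open>x\<^sub>j \<rightarrow> x\<close>.  Letting \<open>j\<close> tend to infinity
  in the perturbed constraints shows that \<open>x\<close> is feasible for \<open>U\<close>.  If \<open>y\<close> is feasible for \<open>U\<close>,
  then \<open>(1 - t) y + t x\<^sub>0\<close>, where \<open>x\<^sub>0\<close> is a strong Slater point, has slack at least \<open>t \<rho>\<close> in all
  constraints, and hence is feasible for \<open>V\<^sub>j\<close> once \<open>j\<close> is large.  So its objective value is at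
  least \<open>c \<bullet> x\<^sub>j\<close>, and \<open>c \<bullet> x \<le> c \<bullet> y\<close> follows by letting first \<open>j \<rightarrow> \<infinity>\<close> and then \<open>t \<rightarrow> 0\<close>.

  Upper semi-continuity follows from closedness by compactness, once the optimal solutions are
  known to be uniformly bounded near \<open>U\<close>.  If they were not, optimal solutions \<open>x\<^sub>j\<close> with
  \<open>norm x\<^sub>j \<rightarrow> \<infinity>\<close> would have normalizations that accumulate at a unit vector \<open>d\<close> with \<open>a \<bullet> d \<ge> 0\<close>
  for all data of \<open>U\<close> and, by comparison with the objective value of \<open>x\<^sub>0\<close>, with \<open>c \<bullet> d \<le> 0\<close>.
  Such a \<open>d\<close> is a recession direction of the optimal set of \<open>U\<close>, which is non-empty and bounded.
\<close>

section \<open>Slack under perturbation of the data\<close>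

lemma RO_opt_iff:
  "x \<in> RO_opt I c V \<longleftrightarrow> x \<in> RO_feasible I V \<and> (\<forall>y\<in>RO_feasible I V. c \<bullet> x \<le> c \<bullet> y)"
proof (cases "x \<in> RO_feasible I V")
  case True
  have "ereal (c \<bullet> x) = RO_value I c V \<longleftrightarrow> ereal (c \<bullet> x) \<le> RO_value I c V"
    using INF_lower[OF True, of "\<lambda>x. ereal (c \<bullet> x)"] unfolding RO_value_def by auto
  then show ?thesis
    using True by (simp add: RO_opt_def RO_value_def le_INF_iff)
qed (simp add: RO_opt_def)

lemma uncertainty_dist_commute: "uncertainty_dist I U V = uncertainty_dist I V U"
  by (simp add: uncertainty_dist_def hausdorff_distance_def max.commute norm_minus_commute)

lemma uncertainty_dist_lessE:
  assumes "uncertainty_dist I U V < ennreal e" "\<alpha> \<in> I" "u \<in> U \<alpha>"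
  obtains v where "v \<in> V \<alpha>" "norm (u - v) < e"
proof -
  have "(INF v\<in>V \<alpha>. ennreal (norm (u - v))) \<le> (SUP u\<in>U \<alpha>. INF v\<in>V \<alpha>. ennreal (norm (u - v)))"
    using assms(3) by (rule SUP_upper)
  also have "\<dots> \<le> hausdorff_distance (U \<alpha>) (V \<alpha>)"
    by (simp add: hausdorff_distance_def)
  also have "\<dots> \<le> uncertainty_dist I U V"
    unfolding uncertainty_dist_def using assms(2) by (rule SUP_upper)
  also note assms(1)
  finally obtain v where "v \<in> V \<alpha>" "ennreal (norm (u - v)) < ennreal e"
    by (auto simp: INF_less_iff)
  then show ?thesis
    using that by (simp add: ennreal_less_iff)
qed

lemma slack_perturbation:
  fixes a a' x :: "'a::real_inner" and b b' e :: real
  assumes "norm ((a', b') - (a, b)) < e"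
  shows "a' \<bullet> x - b' - e * (1 + norm x) \<le> a \<bullet> x - b"
proof -
  have "norm (a' - a) \<le> e" "\<bar>b' - b\<bar> \<le> e"
    using assms norm_fst_le[of "a' - a" "b' - b"] norm_snd_le[of "b' - b" "a' - a"] by auto
  moreover have "(a' - a) \<bullet> x \<le> norm (a' - a) * norm x"
    by (rule norm_cauchy_schwarz)
  moreover have "norm (a' - a) * norm x \<le> e * norm x"
    using \<open>norm (a' - a) \<le> e\<close> by (rule mult_right_mono) simp
  ultimately show ?thesis
    by (simp add: inner_diff_left algebra_simps)
qed

text \<open>The slack \<open>s\<close> may be negative: it then measures how far \<open>x\<close> is from being feasible.\<close>

definition has_slack :: "'i set \<Rightarrow> ('i, 'n::finite) uncertainty \<Rightarrow> real \<Rightarrow> real ^ 'n \<Rightarrow> bool" where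
  "has_slack I V s x \<longleftrightarrow> (\<forall>\<alpha>\<in>I. \<forall>(a, b)\<in>V \<alpha>. b + s \<le> a \<bullet> x)"

lemma RO_feasible_iff_has_slack: "x \<in> RO_feasible I V \<longleftrightarrow> has_slack I V 0 x"
  by (auto simp: RO_feasible_def has_slack_def)

lemma has_slack_mono: "has_slack I V s x \<Longrightarrow> t \<le> s \<Longrightarrow> has_slack I V t x"
  unfolding has_slack_def by fastforce

lemma has_slack_perturbation:
  assumes "has_slack I V s x" "uncertainty_dist I V W < ennreal e"
  shows "has_slack I W (s - e * (1 + norm x)) x"
  unfolding has_slack_def
proof (intro ballI, clarify)
  fix \<alpha> a b assume "\<alpha> \<in> I" "(a, b) \<in> W \<alpha>"
  with assms(2) obtain v where "v \<in> V \<alpha>" "norm ((a, b) - v) < e"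
    using uncertainty_dist_lessE[of I W V] by (metis uncertainty_dist_commute)
  then obtain a' b' where v: "(a', b') \<in> V \<alpha>" "norm ((a', b') - (a, b)) < e"
    by (metis norm_minus_commute surj_pair)
  from assms(1) v(1) \<open>\<alpha> \<in> I\<close> have "b' + s \<le> a' \<bullet> x"
    by (auto simp: has_slack_def)
  with slack_perturbation[OF v(2), of x] show "b + (s - e * (1 + norm x)) \<le> a \<bullet> x"
    by simp
qed

lemma has_slack_convex:
  assumes "has_slack I V s x" "has_slack I V s' y" "0 \<le> t" "t \<le> 1"
  shows "has_slack I V ((1 - t) * s + t * s') ((1 - t) *\<^sub>R x + t *\<^sub>R y)"
  unfolding has_slack_def
proof (intro ballI, clarify)
  fix \<alpha> a b assume ab: "\<alpha> \<in> I" "(a, b) \<in> V \<alpha>"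
  have "(1 - t) * (b + s) + t * (b + s') \<le> (1 - t) * (a \<bullet> x) + t * (a \<bullet> y)"
    using assms ab by (intro add_mono mult_left_mono) (auto simp: has_slack_def)
  then show "b + ((1 - t) * s + t * s') \<le> a \<bullet> ((1 - t) *\<^sub>R x + t *\<^sub>R y)"
    by (simp add: inner_add_right algebra_simps)
qed

text \<open>A point whose slack exceeds the possible perturbation stays feasible for \<open>V\<close>, so that the
  optimal solutions for \<open>V\<close> compete with it.\<close>

lemma RO_opt_le_slack_point:
  assumes "x \<in> RO_opt I c V" "has_slack I U s y" "uncertainty_dist I V U < ennreal e"
    and "e * (1 + norm y) \<le> s"
  shows "c \<bullet> x \<le> c \<bullet> y"
proof -
  have "has_slack I V (s - e * (1 + norm y)) y"
    using assms(2) assms(3)[unfolded uncertainty_dist_commute[of I V]]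
    by (rule has_slack_perturbation)
  then have "y \<in> RO_feasible I V"
    using assms(4) by (auto simp: RO_feasible_iff_has_slack elim: has_slack_mono)
  then show ?thesis
    using assms(1) by (simp add: RO_opt_iff)
qed

section \<open>Limits of optimal solutions\<close>

lemma feasible_limit:
  assumes "\<And>j. x j \<in> RO_feasible I (V j)" "x \<longlonglongrightarrow> z"
    and "\<And>e. e > 0 \<Longrightarrow> \<forall>\<^sub>F j in sequentially. uncertainty_dist I (V j) U < ennreal e"
  shows "z \<in> RO_feasible I U"
  unfolding RO_feasible_def
proof (clarify)
  fix \<alpha> a b assume ab: "\<alpha> \<in> I" "(a, b) \<in> U \<alpha>"
  show "b \<le> a \<bullet> z"
  proof (rule field_le_epsilon)
    fix \<delta> :: real assume "\<delta> > 0"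
    (* With this e, the loss e * (1 + norm z) of slack in the limit is exactly \<delta>. *)
    define e where "e = \<delta> / (1 + norm z)"
    have pos: "1 + norm z > 0"
      by (simp add: add_pos_nonneg)
    with \<open>\<delta> > 0\<close> have e: "e > 0" "e * (1 + norm z) = \<delta>"
      by (auto simp: e_def)
    have "\<forall>\<^sub>F j in sequentially. b - e * (1 + norm (x j)) \<le> a \<bullet> x j"
      using assms(3)[OF e(1)]
    proof eventually_elim
      case (elim j)
      have "has_slack I U (0 - e * (1 + norm (x j))) (x j)"
        using assms(1) elim by (intro has_slack_perturbation) (auto simp: RO_feasible_iff_has_slack)
      then show ?case
        using ab by (auto simp: has_slack_def)
    qed
    moreover have "(\<lambda>j. b - e * (1 + norm (x j))) \<longlonglongrightarrow> b - e * (1 + norm z)"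
      "(\<lambda>j. a \<bullet> x j) \<longlonglongrightarrow> a \<bullet> z"
      by (intro tendsto_intros assms(2))+
    ultimately have "b - e * (1 + norm z) \<le> a \<bullet> z"
      by (auto intro: tendsto_le[OF sequentially_bot])
    then show "b \<le> a \<bullet> z + \<delta>"
      using e(2) by simp
  qed
qed

lemma optimal_limit:
  assumes slater: "strong_Slater I U \<rho>"
    and opt: "\<And>j. x j \<in> RO_opt I c (V j)" and lim: "x \<longlonglongrightarrow> z"
    and dist: "\<And>e. e > 0 \<Longrightarrow> \<forall>\<^sub>F j in sequentially. uncertainty_dist I (V j) U < ennreal e"
  shows "z \<in> RO_opt I c U"
proof -
  obtain x0 where x0: "has_slack I U \<rho> x0" and "\<rho> > 0"
    using slater by (auto simp: strong_Slater_def has_slack_def)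
  have "c \<bullet> z \<le> c \<bullet> y" if y: "y \<in> RO_feasible I U" for y
  proof -
    define w where "w t = (1 - t) *\<^sub>R y + t *\<^sub>R x0" for t :: real
    have le: "c \<bullet> z \<le> c \<bullet> w t" if t: "0 < t" "t < 1" for t
    proof -
      have w: "has_slack I U (t * \<rho>) (w t)"
        using has_slack_convex[OF _ x0, of 0 y t] y t by (simp add: w_def RO_feasible_iff_has_slack)
      define e where "e = t * \<rho> / (1 + norm (w t))"
      have pos: "1 + norm (w t) > 0"
        by (simp add: add_pos_nonneg)
      with t \<open>\<rho> > 0\<close> have e: "e > 0" "e * (1 + norm (w t)) = t * \<rho>"
        by (auto simp: e_def)
      have "\<forall>\<^sub>F j in sequentially. c \<bullet> x j \<le> c \<bullet> w t"
        using dist[OF e(1)] by eventually_elim (use RO_opt_le_slack_point opt w e(2) in force)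
      moreover have "(\<lambda>j. c \<bullet> x j) \<longlonglongrightarrow> c \<bullet> z"
        by (intro tendsto_intros lim)
      ultimately show ?thesis
        by (auto intro: tendsto_upperbound[OF _ _ sequentially_bot])
    qed
    have "(w \<longlongrightarrow> w 0) (at_right 0)"
      unfolding w_def by (intro tendsto_intros)
    then have "((\<lambda>t. c \<bullet> w t) \<longlongrightarrow> c \<bullet> w 0) (at_right 0)"
      by (intro tendsto_intros)
    moreover have "\<forall>\<^sub>F t in at_right 0. c \<bullet> z \<le> c \<bullet> w t"
      using le by (auto simp: eventually_at_right_field intro!: exI[of _ 1])
    ultimately have "c \<bullet> z \<le> c \<bullet> w 0"
      by (intro tendsto_lowerbound) auto
    then show ?thesis
      by (simp add: w_def)
  qed
  moreover have "z \<in> RO_feasible I U"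
    using opt by (intro feasible_limit[OF _ lim dist]) (auto simp: RO_opt_iff)
  ultimately show ?thesis
    by (simp add: RO_opt_iff)
qed

section \<open>Uniform boundedness of optimal solutions\<close>

lemma recession_direction_eq_0:
  assumes "RO_opt I c U \<noteq> {}" "bounded (RO_opt I c U)"
    and "\<And>\<alpha> a b. \<alpha> \<in> I \<Longrightarrow> (a, b) \<in> U \<alpha> \<Longrightarrow> 0 \<le> a \<bullet> d" and "c \<bullet> d \<le> 0"
  shows "d = 0"
proof (rule ccontr)
  assume "d \<noteq> 0"
  obtain y where y: "y \<in> RO_opt I c U"
    using assms(1) by auto
  obtain B where B: "\<And>x. x \<in> RO_opt I c U \<Longrightarrow> norm x \<le> B"
    using assms(2) by (auto simp: bounded_iff)
  have ray: "y + s *\<^sub>R d \<in> RO_opt I c U" if "s \<ge> 0" for s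
  proof -
    have "y + s *\<^sub>R d \<in> RO_feasible I U"
      unfolding RO_feasible_def
    proof (clarify)
      fix \<alpha> a b assume ab: "\<alpha> \<in> I" "(a, b) \<in> U \<alpha>"
      then have "b \<le> a \<bullet> y" "0 \<le> s * (a \<bullet> d)"
        using y assms(3) that by (auto simp: RO_opt_iff RO_feasible_def)
      then show "b \<le> a \<bullet> (y + s *\<^sub>R d)"
        by (simp add: inner_add_right)
    qed
    moreover have "c \<bullet> (y + s *\<^sub>R d) \<le> c \<bullet> y"
      using assms(4) that by (simp add: inner_add_right mult_nonneg_nonpos)
    ultimately show ?thesis
      using y unfolding RO_opt_iff by (meson order_trans)
  qed
  (* At this parameter the ray has travelled a distance B + norm y + 1 from y. *)
  define s where "s = (B + norm y + 1) / norm d"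
  have "B \<ge> 0"
    using B[OF y] norm_ge_zero order_trans by blast
  then have "s \<ge> 0"
    by (simp add: s_def)
  have "norm (s *\<^sub>R d) \<le> norm (y + s *\<^sub>R d) + norm y"
    using norm_triangle_ineq4[of "y + s *\<^sub>R d" y] by simp
  moreover have "norm (s *\<^sub>R d) = B + norm y + 1"
    using \<open>d \<noteq> 0\<close> \<open>B \<ge> 0\<close> by (simp add: s_def)
  ultimately show False
    using B[OF ray[OF \<open>s \<ge> 0\<close>]] by simp
qed

text \<open>Optimal solutions that escape to infinity would accumulate, after normalization, at a
  unit recession direction of the optimal set of \<open>U\<close>.\<close>

lemma RO_opt_locally_bounded:
  fixes U :: "('i, 'n::finite) uncertainty"
  assumes slater: "strong_Slater I U \<rho>"
    and ne: "RO_opt I c U \<noteq> {}" and bdd: "bounded (RO_opt I c U)"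
  obtains k :: nat where "\<And>V x. uncertainty_dist I V U < ennreal (1 / Suc k) \<Longrightarrow>
    x \<in> RO_opt I c V \<Longrightarrow> norm x \<le> Suc k"
proof (rule ccontr)
  assume "\<not> thesis"
  with that have "\<forall>k::nat. \<exists>V x. uncertainty_dist I V U < ennreal (1 / Suc k) \<and>
      x \<in> RO_opt I c V \<and> norm x > Suc k"
    by (meson not_le)
  then obtain V x where dist: "\<And>k. uncertainty_dist I (V k) U < ennreal (1 / Suc k)"
    and opt: "\<And>k::nat. x k \<in> RO_opt I c (V k)" and big: "\<And>k. norm (x k) > Suc k"
    by metis
  obtain x0 where x0: "has_slack I U \<rho> x0" and "\<rho> > 0"
    using slater by (auto simp: strong_Slater_def has_slack_def)
  define N where "N k = inverse (norm (x k))" for k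
  have N_pos: "N k > 0" for k
    unfolding N_def
    by (intro positive_imp_inverse_positive) (rule less_trans[OF _ big[of k]], simp)
  have norm_N: "norm (x k) * N k = 1" for k
    using N_pos[of k] by (auto simp: N_def)
  have e_lim: "(\<lambda>k. 1 / real (Suc k)) \<longlonglongrightarrow> 0"
    using LIMSEQ_Suc[OF lim_1_over_n[where 'a=real]] by simp
  have N_lim: "N \<longlonglongrightarrow> 0"
  proof (rule tendsto_sandwich[OF _ _ tendsto_const e_lim])
    show "\<forall>\<^sub>F k in sequentially. N k \<le> 1 / real (Suc k)"
      unfolding N_def inverse_eq_divide
      by (intro always_eventually allI frac_le) (use big in \<open>auto intro: less_imp_le\<close>)
  qed (use N_pos in \<open>auto intro!: always_eventually less_imp_le\<close>)
  have "\<forall>k. N k *\<^sub>R x k \<in> sphere 0 1"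
    using norm_N N_pos by (simp add: mult.commute abs_of_pos)
  then obtain d r where d: "d \<in> sphere 0 1" and r: "strict_mono r"
    and lim: "((\<lambda>k. N k *\<^sub>R x k) \<circ> r) \<longlonglongrightarrow> d"
    using compact_sphere[of "0 :: real ^ 'n" 1] unfolding compact_def by meson
  note sub = LIMSEQ_subseq_LIMSEQ[OF _ r, unfolded o_def]
  have lim': "(\<lambda>k. N (r k) *\<^sub>R x (r k)) \<longlonglongrightarrow> d"
    using lim by (simp add: o_def)
  have "0 \<le> a \<bullet> d" if ab: "\<alpha> \<in> I" "(a, b) \<in> U \<alpha>" for \<alpha> a b
  proof -
    have low: "b * N k - 1 / Suc k * (N k + 1) \<le> a \<bullet> (N k *\<^sub>R x k)" for k
    proof -
      have "has_slack I U (0 - 1 / Suc k * (1 + norm (x k))) (x k)"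
        using opt dist by (intro has_slack_perturbation)
          (auto simp: RO_opt_iff RO_feasible_iff_has_slack)
      then have "b - 1 / Suc k * (1 + norm (x k)) \<le> a \<bullet> x k"
        using ab by (auto simp: has_slack_def)
      then have "(b - 1 / Suc k * (1 + norm (x k))) * N k \<le> (a \<bullet> x k) * N k"
        using N_pos[of k] by (intro mult_right_mono) auto
      moreover have "(b - 1 / Suc k * (1 + norm (x k))) * N k
          = b * N k - 1 / Suc k * (N k + norm (x k) * N k)"
        by (simp only: algebra_simps)
      ultimately show ?thesis
        unfolding norm_N inner_scaleR_right by (simp only: mult.commute[of _ "N k"])
    qed
    have "(\<lambda>k. b * N (r k) - 1 / Suc (r k) * (N (r k) + 1)) \<longlonglongrightarrow> b * 0 - 0 * (0 + 1)"
      by (intro tendsto_intros sub[OF N_lim] sub[OF e_lim])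
    moreover have "(\<lambda>k. a \<bullet> (N (r k) *\<^sub>R x (r k))) \<longlonglongrightarrow> a \<bullet> d"
      by (intro tendsto_inner tendsto_const lim')
    ultimately have "b * 0 - 0 * (0 + 1) \<le> a \<bullet> d"
      using low by (intro LIMSEQ_le) auto
    then show ?thesis
      by simp
  qed
  moreover have "c \<bullet> d \<le> 0"
  proof -
    have "(\<lambda>k. 1 / real (Suc k) * (1 + norm x0)) \<longlonglongrightarrow> 0 * (1 + norm x0)"
      by (intro tendsto_intros e_lim)
    then have "\<forall>\<^sub>F k in sequentially. 1 / real (Suc k) * (1 + norm x0) < \<rho>"
      using \<open>\<rho> > 0\<close> by (intro order_tendstoD(2)) auto
    then have "\<forall>\<^sub>F k in sequentially. c \<bullet> (N k *\<^sub>R x k) \<le> (c \<bullet> x0) * N k"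
    proof eventually_elim
      case (elim k)
      then have "c \<bullet> x k \<le> c \<bullet> x0"
        using RO_opt_le_slack_point[OF opt x0 dist] by force
      then have "(c \<bullet> x k) * N k \<le> (c \<bullet> x0) * N k"
        using N_pos[of k] by (intro mult_right_mono) auto
      then show ?case
        by (simp add: mult.commute)
    qed
    then have "\<forall>\<^sub>F k in sequentially. c \<bullet> (N (r k) *\<^sub>R x (r k)) \<le> (c \<bullet> x0) * N (r k)"
      by (rule eventually_subseq[OF r])
    moreover have "(\<lambda>k. (c \<bullet> x0) * N (r k)) \<longlonglongrightarrow> (c \<bullet> x0) * 0"
      by (intro tendsto_intros sub[OF N_lim])
    moreover have "(\<lambda>k. c \<bullet> (N (r k) *\<^sub>R x (r k))) \<longlonglongrightarrow> c \<bullet> d"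
      by (intro tendsto_inner tendsto_const lim')
    ultimately have "c \<bullet> d \<le> (c \<bullet> x0) * 0"
      by (intro tendsto_le[OF sequentially_bot])
    then show ?thesis
      by simp
  qed
  ultimately have "d = 0"
    by (rule recession_direction_eq_0[OF ne bdd])
  with d show False
    by simp
qed

section \<open>Closedness and upper semi-continuity\<close>

theorem theorem6p3:
  fixes I :: "'i set" and c :: "real ^ 'n::finite"
    and U :: "'i \<Rightarrow> ((real ^ 'n) \<times> real) set" and \<rho> :: real
  assumes "U \<in> uncertainty_sets I"
    and "strong_Slater I U \<rho>"
    and "RO_opt I c U \<noteq> {}" and "bounded (RO_opt I c U)"
    and "Sup {ereal (- b) | a b \<alpha>. \<alpha> \<in> I \<and> (a, b) \<in> U \<alpha>} < \<infinity>"
  shows "closed_at I (RO_opt I c) U \<and> upper_semicontinuous_at I (RO_opt I c) U"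
proof
  show "closed_at I (RO_opt I c) U"
    unfolding closed_at_def
  proof (intro allI impI)
    fix V :: "nat \<Rightarrow> ('i, 'n) uncertainty" and x xbar
    assume V: "\<forall>j. V j \<in> uncertainty_sets I \<and> x j \<in> RO_opt I c (V j)"
      and lim: "(\<lambda>j. uncertainty_dist I (V j) U) \<longlonglongrightarrow> 0" "x \<longlonglongrightarrow> xbar"
    show "xbar \<in> RO_opt I c U"
    proof (rule optimal_limit[OF assms(2) _ lim(2)])
      show "\<forall>\<^sub>F j in sequentially. uncertainty_dist I (V j) U < ennreal e" if "e > 0" for e
        using lim(1) that by (intro order_tendstoD(2)) auto
    qed (use V in auto)
  qed
next
  obtain k :: nat where k: "\<And>V x. uncertainty_dist I V U < ennreal (1 / Suc k) \<Longrightarrow>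
      x \<in> RO_opt I c V \<Longrightarrow> norm x \<le> Suc k"
    by (rule RO_opt_locally_bounded[OF assms(2-4)]) blast
  show "upper_semicontinuous_at I (RO_opt I c) U"
    unfolding upper_semicontinuous_at_def
  proof (intro allI impI, rule ccontr)
    fix S assume S: "open S \<and> RO_opt I c U \<subseteq> S"
      and contra: "\<not> (\<exists>\<epsilon>::real. \<epsilon> > 0 \<and> (\<forall>V\<in>uncertainty_sets I.
        uncertainty_dist I V U < ennreal \<epsilon> \<longrightarrow> RO_opt I c V \<subseteq> S))"
    (* Starting the radii at 1 / Suc k keeps the whole sequence in the region of boundedness. *)
    have "\<exists>V x. uncertainty_dist I V U < ennreal (1 / Suc (k + j)) \<and>
        x \<in> RO_opt I c V \<and> x \<notin> S" for j
      using contra[unfolded not_ex, THEN spec, of "1 / Suc (k + j)"] by auto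
    then obtain V x where dist: "\<And>j. uncertainty_dist I (V j) U < ennreal (1 / Suc (k + j))"
      and opt: "\<And>j. x j \<in> RO_opt I c (V j)" and out: "\<And>j. x j \<notin> S"
      by metis
    have dist_k: "uncertainty_dist I (V j) U < ennreal (1 / Suc k)" for j
      by (rule less_le_trans[OF dist ennreal_leI]) (simp add: frac_le)
    have "\<forall>j. x j \<in> cball 0 (Suc k)"
      using k[OF dist_k opt] by simp
    then obtain z r where r: "strict_mono r" and lim: "(x \<circ> r) \<longlonglongrightarrow> z"
      using compact_cball[of "0 :: real ^ 'n" "Suc k"] unfolding compact_def by meson
    have dist_ev: "\<forall>\<^sub>F j in sequentially. uncertainty_dist I (V j) U < ennreal e" if "e > 0" for e
    proof -
      obtain m where m: "1 / Suc m < e"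
        using \<open>e > 0\<close> nat_approx_posE by blast
      have "uncertainty_dist I (V j) U < ennreal e" if "j \<ge> m" for j
      proof (rule less_le_trans[OF dist ennreal_leI])
        have "1 / real (Suc (k + j)) \<le> 1 / real (Suc m)"
          using that by (intro divide_left_mono) auto
        with m show "1 / real (Suc (k + j)) \<le> e"
          by simp
      qed
      then show ?thesis
        by (auto simp: eventually_sequentially)
    qed
    have "z \<in> RO_opt I c U"
    proof (rule optimal_limit[OF assms(2) _ lim])
      show "(x \<circ> r) j \<in> RO_opt I c ((V \<circ> r) j)" for j
        using opt by simp
      show "\<forall>\<^sub>F j in sequentially. uncertainty_dist I ((V \<circ> r) j) U < ennreal e" if "e > 0" for e
        using eventually_subseq[OF r dist_ev[OF that]] by simp
    qed
    moreover have "z \<in> - S"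
      using S out by (intro closed_sequentially[OF _ _ lim]) auto
    ultimately show False
      using S by auto
  qed
qed

end
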